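(* Let $G=\mathrm{GIRG}(n,\beta,w_0,d)$ be a standard GIRG with $d=\omega(\log n)$ and let $U_k=\{v_1,\dots,v_k\}$ be a set of $k$ vertices chosen uniformly at random, with weights $w_1,\dots,w_k$. Then for every $\mathcal{A}\subseteq\binom{U_k}{2}$, $$\Pr\Big[E(U_k)\supseteq\mathcal{A}\ \Big|\ \{\kappa\}^{(k)}\Big]\ge\prod_{i=1}^k\Big(1-\sum_{\{i,j\}\in\mathcal{A}_i^-}\Big(1-\Big(\frac{\kappa_{ij}}{n}\Big)^{1/d}\Big)\Big)^d,$$ where $\mathcal{A}_i^-=\{\{i,j\}\in\mathcal{A}\mid j\le i\}$ is the set of edges in $\mathcal{A}$ between $v_i$ and a vertex of smaller index.
   Context: Fix constants $\lambda>0$, $w_0>0$, $\beta>2$. A standard GIRG $\mathrm{GIRG}(n,\beta,w_0,d)$ has $n$ vertices; each vertex $v$ independently receives a weight $w_v$ with $\Pr[w_v\le x]=1-(x/w_0)^{1-\beta}$ for $x\ge w_0$, and independently a position $\mathbf{x}_v$ uniform on the torus $\mathbb{T}^d=[0,1)^d$. The distance is $d(\mathbf{x}_u,\mathbf{x}_v)=\max_{1\le i\le d}|x_{ui}-x_{vi}|_C$ with $|a-b|_C=\min\{|a-b|,1-|a-b|\}$. Distinct $u,v$ are adjacent iff $d(\mathbf{x}_u,\mathbf{x}_v)\le \frac12\big(\frac{\lambda w_uw_v}{n}\big)^{1/d}$. The dimension $d=d(n)$ depends on $n$. Notation: $\kappa_{ij}=\min\{\lambda w_iw_j,n\}$, $\{\kappa\}^{(k)}=\{\kappa_{ij}\mid1\le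 i<j\le k\}$, and $E(U_k)$ is the (random) set of edges of $G$ among vertices of $U_k$ (edges identified with index pairs $\{i,j\}$). *)

theory Defs
  imports "HOL-Probability.Probability" "HOL-Library.Landau_Symbols"
begin

definition circle_dist :: "real \<Rightarrow> real \<Rightarrow> real" where
  "circle_dist a b = min \<bar>a - b\<bar> (1 - \<bar>a - b\<bar>)"

definition torus_dist :: "nat \<Rightarrow> (nat \<Rightarrow> real) \<Rightarrow> (nat \<Rightarrow> real) \<Rightarrow> real" where
  "torus_dist d x y = Max ((\<lambda>i. circle_dist (x i) (y i)) ` {1..d})"

definition weight_cdf :: "real \<Rightarrow> real \<Rightarrow> real \<Rightarrow> real" where
  "weight_cdf w0 \<beta> x = (if x < w0 then 0 else 1 - (x / w0) powr (1 - \<beta>))"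

definition weight_measure :: "real \<Rightarrow> real \<Rightarrow> real measure" where
  "weight_measure w0 \<beta> = interval_measure (weight_cdf w0 \<beta>)"

lemma
  assumes "w0 > 0" and "\<beta> > 2"
  shows real_distribution_weight_measure: "real_distribution (weight_measure w0 \<beta>)"
    and measure_weight_measure_Iic: "measure (weight_measure w0 \<beta>) {..x} = weight_cdf w0 \<beta> x"
proof -
  let ?F = "weight_cdf w0 \<beta>"
  have mono: "?F x \<le> ?F y" if "x \<le> y" for x y
  proof -
    have "(y / w0) powr (1 - \<beta>) \<le> (x / w0) powr (1 - \<beta>)" if "w0 \<le> x"
      using that \<open>x \<le> y\<close> assms by (intro powr_mono2') (auto simp: divide_right_mono)
    moreover have "(y / w0) powr (1 - \<beta>) \<le> 1" if "w0 \<le> y"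
      using powr_mono2'[of "1 - \<beta>" 1 "y / w0"] that assms by (auto simp: field_simps)
    ultimately show ?thesis
      using that by (auto simp: weight_cdf_def)
  qed
  have cont: "continuous (at_right a) ?F" for a
  proof (cases "a < w0")
    case True
    then have "eventually (\<lambda>x. ?F x = 0) (at_right a)"
      by (auto simp: eventually_at_right weight_cdf_def intro!: exI[of _ w0])
    then show ?thesis
      using True by (simp add: continuous_within weight_cdf_def tendsto_eventually)
  next
    case False
    have "((\<lambda>x. 1 - (x / w0) powr (1 - \<beta>)) \<longlongrightarrow> 1 - (a / w0) powr (1 - \<beta>)) (at_right a)"
      using False assms by (intro tendsto_intros) auto
    moreover have "eventually (\<lambda>x. 1 - (x / w0) powr (1 - \<beta>) = ?F x) (at_right a)"
      using eventually_at_right_less[of a]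
      by eventually_elim (use False in \<open>auto simp: weight_cdf_def\<close>)
    ultimately have "(?F \<longlongrightarrow> 1 - (a / w0) powr (1 - \<beta>)) (at_right a)"
      by (rule Lim_transform_eventually)
    then show ?thesis
      using False by (simp add: continuous_within weight_cdf_def)
  qed
  have bot: "(?F \<longlongrightarrow> 0) at_bot"
    by (rule tendsto_eventually)
       (auto simp: eventually_at_bot_dense weight_cdf_def intro!: exI[of _ w0])
  have top: "(?F \<longlongrightarrow> 1) at_top"
  proof -
    have "filterlim (\<lambda>x. x / w0) at_top at_top"
      using assms by (simp add: divide_inverse filterlim_at_top_mult_tendsto_pos[OF tendsto_const] filterlim_ident)
    then have "((\<lambda>x. (x / w0) powr (1 - \<beta>)) \<longlongrightarrow> 0) at_top"
      using assms by (intro tendsto_neg_powr) auto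
    then have "((\<lambda>x. 1 - (x / w0) powr (1 - \<beta>)) \<longlongrightarrow> 1 - 0) at_top"
      by (intro tendsto_intros)
    moreover have "eventually (\<lambda>x. 1 - (x / w0) powr (1 - \<beta>) = ?F x) at_top"
      by (auto simp: eventually_at_top_linorder weight_cdf_def intro!: exI[of _ w0])
    ultimately show ?thesis
      using Lim_transform_eventually by fastforce
  qed
  show "real_distribution (weight_measure w0 \<beta>)"
    unfolding weight_measure_def by (rule real_distribution_interval_measure[OF mono cont bot top])
  show "measure (weight_measure w0 \<beta>) {..x} = weight_cdf w0 \<beta> x"
    unfolding weight_measure_def by (rule measure_interval_measure_Iic[OF mono cont bot])
qed

definition torus_measure :: "nat \<Rightarrow> (nat \<Rightarrow> real) measure" where
  "torus_measure d = (\<Pi>\<^sub>M i\<in>{1..d}. uniform_measure lborel {0..<1})"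

definition girg_measure ::
    "nat \<Rightarrow> real \<Rightarrow> real \<Rightarrow> nat \<Rightarrow> ((nat \<Rightarrow> real) \<times> (nat \<Rightarrow> nat \<Rightarrow> real)) measure" where
  "girg_measure n \<beta> w0 d =
     (\<Pi>\<^sub>M v\<in>{1..n}. weight_measure w0 \<beta>) \<Otimes>\<^sub>M (\<Pi>\<^sub>M v\<in>{1..n}. torus_measure d)"

definition girg_adj ::
    "real \<Rightarrow> nat \<Rightarrow> nat \<Rightarrow> (nat \<Rightarrow> real) \<times> (nat \<Rightarrow> nat \<Rightarrow> real) \<Rightarrow> nat \<Rightarrow> nat \<Rightarrow> bool" where
  "girg_adj lam n d = (\<lambda>(w, x) u v. u \<noteq> v \<and>
     torus_dist d (x u) (x v) \<le> 1 / 2 * (lam * w u * w v / real n) powr (1 / real d))"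

text \<open>
  A uniformly random \<open>k\<close>-set of vertices together with its labelling \<open>v 1, \<dots>, v k\<close> is a
  uniformly random injective map from \<open>{1..k}\<close> to \<open>{1..n}\<close>; its range is then uniform among the
  \<open>k\<close>-subsets.
\<close>

definition vertex_choices :: "nat \<Rightarrow> nat \<Rightarrow> (nat \<Rightarrow> nat) set" where
  "vertex_choices n k = {v \<in> {1..k} \<rightarrow>\<^sub>E {1..n}. inj_on v {1..k}}"

lemma finite_vertex_choices: "finite (vertex_choices n k)"
  unfolding vertex_choices_def by (rule finite_subset[OF _ finite_PiE[of "{1..k}" "\<lambda>_. {1..n}"]]) auto

type_synonym sample = "((nat \<Rightarrow> real) \<times> (nat \<Rightarrow> nat \<Rightarrow> real)) \<times> (nat \<Rightarrow> nat)"

definition sample_measure :: "nat \<Rightarrow> real \<Rightarrow> real \<Rightarrow> nat \<Rightarrow> nat \<Rightarrow> sample measure" where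
  "sample_measure n \<beta> w0 d k =
     girg_measure n \<beta> w0 d \<Otimes>\<^sub>M uniform_count_measure (vertex_choices n k)"

lemma prob_space_torus_measure: "prob_space (torus_measure d)"
  unfolding torus_measure_def
  by (intro prob_space_PiM prob_space_uniform_measure) auto

lemma prob_space_girg_measure:
  assumes "w0 > 0" and "\<beta> > 2"
  shows "prob_space (girg_measure n \<beta> w0 d)"
  unfolding girg_measure_def
  using real_distribution_weight_measure[OF assms]
  by (intro prob_space_pair prob_space_PiM prob_space_torus_measure)
     (auto simp: real_distribution_def)

lemma prob_space_sample_measure:
  assumes "w0 > 0" and "\<beta> > 2" and "k \<le> n"
  shows "prob_space (sample_measure n \<beta> w0 d k)"
proof -
  have "finite (vertex_choices n k)"
    by (rule finite_vertex_choices)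
  moreover have "(\<lambda>i\<in>{1..k}. i) \<in> vertex_choices n k"
    using assms(3) by (auto simp: vertex_choices_def inj_on_def)
  ultimately have "prob_space (uniform_count_measure (vertex_choices n k))"
    by (intro prob_space_uniform_count_measure) auto
  then show ?thesis
    unfolding sample_measure_def
    by (intro prob_space_pair prob_space_girg_measure assms)
qed

definition index_pairs :: "nat \<Rightarrow> nat set set" where
  "index_pairs k = {{i, j} | i j. 1 \<le> i \<and> i < j \<and> j \<le> k}"

definition chosen_edges :: "real \<Rightarrow> nat \<Rightarrow> nat \<Rightarrow> nat \<Rightarrow> sample \<Rightarrow> nat set set" where
  "chosen_edges lam n d k = (\<lambda>(g, v).
     {{i, j} | i j. i \<in> {1..k} \<and> j \<in> {1..k} \<and> girg_adj lam n d g (v i) (v j)})"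

definition kappa :: "real \<Rightarrow> nat \<Rightarrow> sample \<Rightarrow> nat \<Rightarrow> nat \<Rightarrow> real" where
  "kappa lam n = (\<lambda>((w, x), v) i j. min (lam * w (v i) * w (v j)) (real n))"

text \<open>
  \<open>kappa_algebra lam n k M\<close> is the sigma-algebra on the space of \<open>M\<close> generated by the family of all
  \<open>\<kappa>\<^sub>i\<^sub>j\<close> with \<open>1 \<le> i < j \<le> k\<close>.
\<close>

definition kappa_algebra :: "real \<Rightarrow> nat \<Rightarrow> nat \<Rightarrow> sample measure \<Rightarrow> sample measure" where
  "kappa_algebra lam n k M =
     (let P = {(i, j). 1 \<le> i \<and> i < j \<and> j \<le> k}
      in vimage_algebra (space M) (\<lambda>\<omega>. \<lambda>(i, j)\<in>P. kappa lam n \<omega> i j) (\<Pi>\<^sub>M p\<in>P. borel))"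

definition cond_prob_algebra :: "'a measure \<Rightarrow> 'a measure \<Rightarrow> ('a \<Rightarrow> bool) \<Rightarrow> 'a \<Rightarrow> real" where
  "cond_prob_algebra M F P = real_cond_exp M F (indicator {\<omega> \<in> space M. P \<omega>})"

text \<open>
  \<^const>\<open>real_cond_exp\<close> silently yields \<open>0\<close> unless the conditioning object is a subalgebra and
  the integrand is measurable; \<open>subalgebra_kappa_algebra\<close> and \<open>sets_chosen_edges\<close> below rule this
  out.
\<close>

lemma sets_weight_measure [measurable_cong, simp]: "sets (weight_measure w0 \<beta>) = sets borel"
  by (simp add: weight_measure_def)

lemma measurable_weight_component:
  assumes "i \<in> {1..k}"
  shows "(\<lambda>\<omega>. fst (fst \<omega>) (snd \<omega> i)) \<in> borel_measurable (sample_measure n \<beta> w0 d k)"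
proof -
  let ?C = "uniform_count_measure (vertex_choices n k)"
  let ?G = "girg_measure n \<beta> w0 d"
  have fin: "finite (vertex_choices n k)"
    by (rule finite_vertex_choices)
  have "(\<lambda>\<omega>. (\<lambda>v \<omega>. fst (fst \<omega>) (v i)) (snd \<omega>) \<omega>) \<in> borel_measurable (?G \<Otimes>\<^sub>M ?C)"
  proof (rule measurable_compose_countable'[where I = "vertex_choices n k" and g = snd
        and f = "\<lambda>v \<omega>. fst (fst \<omega>) (v i)"])
    fix v assume "v \<in> vertex_choices n k"
    then have "v i \<in> {1..n}"
      using assms by (auto simp: vertex_choices_def)
    then have "(\<lambda>g. fst g (v i)) \<in> borel_measurable ?G"
      unfolding girg_measure_def by measurable
    then show "(\<lambda>\<omega>. fst (fst \<omega>) (v i)) \<in> borel_measurable (?G \<Otimes>\<^sub>M ?C)"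
      by measurable
  next
    have "sets ?C = sets (count_space (vertex_choices n k))"
      by (simp add: uniform_count_measure_def sets_point_measure)
    then show "snd \<in> ?G \<Otimes>\<^sub>M ?C \<rightarrow>\<^sub>M count_space (vertex_choices n k)"
      by (metis measurable_cong_sets measurable_snd)
  qed (use fin in \<open>simp add: countable_finite\<close>)
  then show ?thesis
    by (simp add: sample_measure_def)
qed

lemma measurable_position_component:
  assumes "i \<in> {1..k}" and "l \<in> {1..d}"
  shows "(\<lambda>\<omega>. snd (fst \<omega>) (snd \<omega> i) l) \<in> borel_measurable (sample_measure n \<beta> w0 d k)"
proof -
  let ?C = "uniform_count_measure (vertex_choices n k)"
  let ?G = "girg_measure n \<beta> w0 d"
  have fin: "finite (vertex_choices n k)"
    by (rule finite_vertex_choices)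
  have "(\<lambda>\<omega>. (\<lambda>v \<omega>. snd (fst \<omega>) (v i) l) (snd \<omega>) \<omega>) \<in> borel_measurable (?G \<Otimes>\<^sub>M ?C)"
  proof (rule measurable_compose_countable'[where I = "vertex_choices n k" and g = snd
        and f = "\<lambda>v \<omega>. snd (fst \<omega>) (v i) l"])
    fix v assume "v \<in> vertex_choices n k"
    then have "v i \<in> {1..n}"
      using assms by (auto simp: vertex_choices_def)
    then have "(\<lambda>g. snd g (v i)) \<in> ?G \<rightarrow>\<^sub>M torus_measure d"
      unfolding girg_measure_def by measurable
    moreover have "(\<lambda>y. y l) \<in> borel_measurable (torus_measure d)"
      unfolding torus_measure_def using assms(2) by measurable
    ultimately have "(\<lambda>g. snd g (v i) l) \<in> borel_measurable ?G"
      by (rule measurable_compose)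
    then show "(\<lambda>\<omega>. snd (fst \<omega>) (v i) l) \<in> borel_measurable (?G \<Otimes>\<^sub>M ?C)"
      by measurable
  next
    have "sets ?C = sets (count_space (vertex_choices n k))"
      by (simp add: uniform_count_measure_def sets_point_measure)
    then show "snd \<in> ?G \<Otimes>\<^sub>M ?C \<rightarrow>\<^sub>M count_space (vertex_choices n k)"
      by (metis measurable_cong_sets measurable_snd)
  qed (use fin in \<open>simp add: countable_finite\<close>)
  then show ?thesis
    by (simp add: sample_measure_def)
qed

lemma subalgebra_kappa_algebra:
  fixes n d k :: nat and \<beta> w0 :: real
  defines "M \<equiv> sample_measure n \<beta> w0 d k"
  shows "subalgebra M (kappa_algebra lam n k M)"
proof -
  let ?P = "{(i, j). 1 \<le> i \<and> i < j \<and> j \<le> k}"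
  let ?f = "\<lambda>\<omega>. \<lambda>(i, j)\<in>?P. kappa lam n \<omega> i j"
  have "?f \<in> M \<rightarrow>\<^sub>M (\<Pi>\<^sub>M p\<in>?P. borel)"
  proof (rule measurable_restrict, clarify)
    fix i j :: nat assume "1 \<le> i" "i < j" "j \<le> k"
    then have [measurable]: "(\<lambda>\<omega>. fst (fst \<omega>) (snd \<omega> i)) \<in> borel_measurable M"
        "(\<lambda>\<omega>. fst (fst \<omega>) (snd \<omega> j)) \<in> borel_measurable M"
      unfolding M_def by (auto intro!: measurable_weight_component)
    show "(\<lambda>\<omega>. kappa lam n \<omega> i j) \<in> borel_measurable M"
      unfolding kappa_def split_beta by measurable
  qed
  then show ?thesis
    by (simp add: subalgebra_def kappa_algebra_def Let_def sets_image_in_sets)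
qed

lemma sets_chosen_edges:
  fixes n d k :: nat and \<beta> w0 :: real
  assumes "A \<subseteq> index_pairs k" and "d > 0"
  defines "M \<equiv> sample_measure n \<beta> w0 d k"
  shows "{\<omega> \<in> space M. A \<subseteq> chosen_edges lam n d k \<omega>} \<in> sets M"
proof -
  have adj: "Measurable.pred M (\<lambda>\<omega>. girg_adj lam n d (fst \<omega>) (snd \<omega> i) (snd \<omega> j))"
    if ij: "i \<in> {1..k}" "j \<in> {1..k}" "i \<noteq> j" for i j
  proof -
    have w: "(\<lambda>\<omega>. fst (fst \<omega>) (snd \<omega> i)) \<in> borel_measurable M"
        "(\<lambda>\<omega>. fst (fst \<omega>) (snd \<omega> j)) \<in> borel_measurable M"
      unfolding M_def using ij by (auto intro!: measurable_weight_component)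
    have "Measurable.pred M (\<lambda>\<omega>.
        circle_dist (snd (fst \<omega>) (snd \<omega> i) l) (snd (fst \<omega>) (snd \<omega> j) l)
        \<le> 1 / 2 * (lam * fst (fst \<omega>) (snd \<omega> i) * fst (fst \<omega>) (snd \<omega> j) / real n) powr (1 / real d))"
      if "l \<in> {1..d}" for l
    proof -
      have x: "(\<lambda>\<omega>. snd (fst \<omega>) (snd \<omega> i) l) \<in> borel_measurable M"
          "(\<lambda>\<omega>. snd (fst \<omega>) (snd \<omega> j) l) \<in> borel_measurable M"
        unfolding M_def using ij that by (auto intro!: measurable_position_component)
      have "(\<lambda>\<omega>. circle_dist (snd (fst \<omega>) (snd \<omega> i) l) (snd (fst \<omega>) (snd \<omega> j) l)) \<in> borel_measurable M"
        unfolding circle_dist_def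
        by (intro borel_measurable_min borel_measurable_abs borel_measurable_diff borel_measurable_const x)
      moreover have "(\<lambda>\<omega>. 1 / 2 * (lam * fst (fst \<omega>) (snd \<omega> i) * fst (fst \<omega>) (snd \<omega> j) / real n) powr (1 / real d))
          \<in> borel_measurable M"
        by (intro borel_measurable_times powr_real_measurable borel_measurable_divide borel_measurable_const w)
      ultimately show ?thesis
        unfolding pred_def by (rule borel_measurable_le)
    qed
    then have "Measurable.pred M (\<lambda>\<omega>. \<forall>l\<in>{1..d}.
        circle_dist (snd (fst \<omega>) (snd \<omega> i) l) (snd (fst \<omega>) (snd \<omega> j) l)
        \<le> 1 / 2 * (lam * fst (fst \<omega>) (snd \<omega> i) * fst (fst \<omega>) (snd \<omega> j) / real n) powr (1 / real d))"
      by (intro pred_intros_finite(3)) auto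
    then show ?thesis
    proof (rule measurable_cong[THEN iffD1, rotated])
      fix \<omega> assume "\<omega> \<in> space M"
      then have "inj_on (snd \<omega>) {1..k}"
        by (auto simp: M_def sample_measure_def space_pair_measure vertex_choices_def
            space_uniform_count_measure)
      then have "snd \<omega> i \<noteq> snd \<omega> j"
        using ij by (auto simp: inj_on_eq_iff)
      then show "(\<forall>l\<in>{1..d}.
        circle_dist (snd (fst \<omega>) (snd \<omega> i) l) (snd (fst \<omega>) (snd \<omega> j) l)
        \<le> 1 / 2 * (lam * fst (fst \<omega>) (snd \<omega> i) * fst (fst \<omega>) (snd \<omega> j) / real n) powr (1 / real d))
        = girg_adj lam n d (fst \<omega>) (snd \<omega> i) (snd \<omega> j)"
        using assms(2) unfolding girg_adj_def split_beta torus_dist_def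
        by (subst Max_le_iff) (simp_all del: le_divide_eq_numeral1 times_divide_eq_left)
    qed
  qed
  have "finite A"
  proof (rule finite_subset[OF assms(1)], rule finite_subset)
    show "index_pairs k \<subseteq> Pow {1..k}" by (auto simp: index_pairs_def)
  qed simp
  moreover have "Measurable.pred M (\<lambda>\<omega>. e \<in> chosen_edges lam n d k \<omega>)" if "e \<in> A" for e
  proof -
    from that assms(1) obtain i j where e: "e = {i, j}" "1 \<le> i" "i < j" "j \<le> k"
      by (auto simp: index_pairs_def)
    have "girg_adj lam n d (fst \<omega>) (snd \<omega> i) (snd \<omega> j) \<or> girg_adj lam n d (fst \<omega>) (snd \<omega> j) (snd \<omega> i)
        \<longleftrightarrow> e \<in> chosen_edges lam n d k \<omega>" for \<omega>
    proof
      assume "girg_adj lam n d (fst \<omega>) (snd \<omega> i) (snd \<omega> j)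
        \<or> girg_adj lam n d (fst \<omega>) (snd \<omega> j) (snd \<omega> i)"
      moreover have "{i, j} = {j, i}" "i \<in> {1..k}" "j \<in> {1..k}"
        using e by auto
      ultimately show "e \<in> chosen_edges lam n d k \<omega>"
        unfolding chosen_edges_def split_beta e(1) by blast
    next
      assume "e \<in> chosen_edges lam n d k \<omega>"
      then show "girg_adj lam n d (fst \<omega>) (snd \<omega> i) (snd \<omega> j)
        \<or> girg_adj lam n d (fst \<omega>) (snd \<omega> j) (snd \<omega> i)"
        by (auto simp: chosen_edges_def split_beta e(1) doubleton_eq_iff)
    qed
    moreover have "Measurable.pred M (\<lambda>\<omega>. girg_adj lam n d (fst \<omega>) (snd \<omega> i) (snd \<omega> j)
        \<or> girg_adj lam n d (fst \<omega>) (snd \<omega> j) (snd \<omega> i))"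
      using e by (intro pred_intros_logic adj) auto
    ultimately show ?thesis by simp
  qed
  ultimately have "Measurable.pred M (\<lambda>\<omega>. \<forall>e\<in>A. e \<in> chosen_edges lam n d k \<omega>)"
    by (rule pred_intros_finite(3))
  then show ?thesis
    by (simp add: subset_iff pred_def Ball_def)
qed

definition lower_edges :: "nat set set \<Rightarrow> nat \<Rightarrow> nat set set" where
  "lower_edges A i = {{i, j} | j. {i, j} \<in> A \<and> j \<le> i}"

end

theory Submission
  imports Defs "HOL-Real_Asymp.Real_Asymp"
begin

text \<open>
  Given the weights and the choice of vertices, reveal the positions of \<open>v 1, \<dots>, v k\<close> one after the
  other. In each coordinate a uniform point is within circle distance \<open>p / 2\<close> of a given point
  with probability \<open>p\<close>, so by the union bound \<open>v i\<close> meets all constraints towards earlier vertices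
  in that coordinate with probability at least \<open>1 - (\<Sum>j. 1 - p j)\<close>, and the \<open>d\<close> coordinates are
  independent. Since \<open>d\<close> grows faster than \<open>ln n\<close>, all \<open>p j\<close> tend to \<open>1\<close> uniformly, so these bounds
  are eventually nonnegative and may be multiplied. The resulting product is a function of the
  \<open>\<kappa>\<^sub>i\<^sub>j\<close> alone, so it also bounds the probability conditioned on the coarser sigma-algebra.
\<close>

section \<open>Revealing independent points one after the other\<close>

text \<open>Induction on \<open>k\<close>: by Fubini the last point is integrated innermost, and
  once the earlier points satisfy their constraints, its section has mass at least
  \<open>c (Suc k)\<close>. Membership in \<open>D\<close> belongs to the event so that
  \<open>step\<close> may assume it of all earlier points. Values in \<open>ennreal\<close> let the
  bounds be multiplied without sign conditions.\<close>

lemma sequential_constraints_prob_ge: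
  fixes T :: "'a measure" and Q :: "nat \<Rightarrow> nat \<Rightarrow> 'a \<Rightarrow> 'a \<Rightarrow> bool" and c :: "nat \<Rightarrow> ennreal"
  assumes T: "prob_space T" and D [measurable]: "D \<in> sets T"
    and Q [measurable]: "\<And>i j. Measurable.pred (T \<Otimes>\<^sub>M T) (\<lambda>p. Q i j (fst p) (snd p))"
    and L: "\<And>i. L i \<subseteq> {1..<i}"
    and step: "\<And>i x. i \<in> {1..k} \<Longrightarrow> (\<And>j. j \<in> {1..<i} \<Longrightarrow> x j \<in> D) \<Longrightarrow>
      c i \<le> emeasure T {y \<in> space T. y \<in> D \<and> (\<forall>j\<in>L i. Q i j y (x j))}"
  shows "(\<Prod>i=1..k. c i) \<le> emeasure (\<Pi>\<^sub>M i\<in>{1..k}. T)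
    {x \<in> space (\<Pi>\<^sub>M i\<in>{1..k}. T). \<forall>i\<in>{1..k}. x i \<in> D \<and> (\<forall>j\<in>L i. Q i j (x i) (x j))}"
  using step
proof (induction k)
  case 0
  then show ?case
    by (simp add: PiM_empty)
next
  case (Suc k)
  interpret T: prob_space T by fact
  interpret P: product_sigma_finite "\<lambda>_::nat. T" ..
  have fin: "finite (L i)" for i
    using L finite_subset by blast
  define C where "C m x \<longleftrightarrow> (\<forall>i\<in>{1..m}. x i \<in> D \<and> (\<forall>j\<in>L i. Q i j (x i) (x j)))" for m x
  \<comment> \<open>\<open>I\<close> is left free because the predicate is used over
    \<open>{1..k}\<close> and over \<open>{1..Suc k}\<close>, the latter also written as an
    \<open>insert\<close>, the form that Fubini needs.\<close>
  have ms: "Measurable.pred (\<Pi>\<^sub>M i\<in>I. T) (\<lambda>x. C m x)" if "{1..m} \<subseteq> I" for m I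
  proof -
    have "Measurable.pred (\<Pi>\<^sub>M i\<in>I. T) (\<lambda>x. Q i j (x i) (x j))" if "i \<in> I" "j \<in> I" for i j
    proof -
      have "(\<lambda>x. (x i, x j)) \<in> (\<Pi>\<^sub>M i\<in>I. T) \<rightarrow>\<^sub>M T \<Otimes>\<^sub>M T"
        using that by measurable
      from measurable_compose[OF this Q] show ?thesis by simp
    qed
    moreover have "Measurable.pred (\<Pi>\<^sub>M i\<in>I. T) (\<lambda>x. x i \<in> D)" if "i \<in> I" for i
      using that by measurable
    moreover have "j \<in> I" if "i \<in> {1..m}" "j \<in> L i" for i j
      using that L[of i] \<open>{1..m} \<subseteq> I\<close> by (auto simp: subset_iff)
    ultimately show ?thesis
      unfolding C_def using that fin
      by (intro pred_intros_finite(3) pred_intros_logic) auto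
  qed
  let ?P = "\<lambda>k. \<Pi>\<^sub>M i\<in>{1..k}. T"
  have ins: "{1..Suc k} = insert (Suc k) {1..k}" by auto
  have "(\<Prod>i=1..Suc k. c i) = (\<Prod>i=1..k. c i) * c (Suc k)"
    by simp
  also have "\<dots> \<le> emeasure (?P k) {x \<in> space (?P k). C k x} * c (Suc k)"
    unfolding C_def by (intro mult_right_mono Suc.IH Suc.prems) auto
  also have "\<dots> = (\<integral>\<^sup>+x. indicator {x \<in> space (?P k). C k x} x * c (Suc k) \<partial>?P k)"
    using ms[of k "{1..k}"] by (subst nn_integral_multc) (auto simp: pred_def)
  \<comment> \<open>Compared fibrewise in the first \<open>k\<close> points: the left integrand
    vanishes where \<open>C k x\<close> fails, and elsewhere \<open>step\<close> bounds the section
    over \<open>x\<close>.\<close>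
  also have "\<dots> \<le> (\<integral>\<^sup>+x. (\<integral>\<^sup>+y. indicator {x \<in> space (?P (Suc k)). C (Suc k) x} (x(Suc k := y)) \<partial>T) \<partial>?P k)"
  proof (intro nn_integral_mono)
    fix x assume x: "x \<in> space (?P k)"
    show "indicator {x \<in> space (?P k). C k x} x * c (Suc k)
      \<le> (\<integral>\<^sup>+y. indicator {x \<in> space (?P (Suc k)). C (Suc k) x} (x(Suc k := y)) \<partial>T)"
    proof (cases "C k x")
      case True
      define B where "B = {y \<in> space T. y \<in> D \<and> (\<forall>j\<in>L (Suc k). Q (Suc k) j y (x j))}"
      have xj: "x j \<in> space T" if "j \<in> {1..k}" for j
        using x that by (auto simp: space_PiM)
      have "Measurable.pred T (\<lambda>y. Q (Suc k) j y (x j))" if "j \<in> L (Suc k)" for j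
      proof -
        have "x j \<in> space T" using L[of "Suc k"] that xj by fastforce
        then have "(\<lambda>y. (y, x j)) \<in> T \<rightarrow>\<^sub>M T \<Otimes>\<^sub>M T" by measurable
        from measurable_compose[OF this Q] show ?thesis by simp
      qed
      then have "Measurable.pred T (\<lambda>y. y \<in> D \<and> (\<forall>j\<in>L (Suc k). Q (Suc k) j y (x j)))"
        using fin by (intro pred_intros_logic pred_intros_finite(3)) auto
      then have B: "B \<in> sets T" by (simp add: B_def pred_def)
      have "c (Suc k) \<le> emeasure T B"
        unfolding B_def using True by (intro Suc.prems) (auto simp: C_def)
      also have "\<dots> = (\<integral>\<^sup>+y. indicator B y \<partial>T)"
        using B by simp
      also have "\<dots> \<le> (\<integral>\<^sup>+y. indicator {x \<in> space (?P (Suc k)). C (Suc k) x} (x(Suc k := y)) \<partial>T)"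
      proof (intro nn_integral_mono)
        fix y assume y: "y \<in> space T"
        have "C (Suc k) (x(Suc k := y))" if "y \<in> B"
          unfolding C_def
        proof
          fix i assume i: "i \<in> {1..Suc k}"
          \<comment> \<open>Constraints look only backwards, so updating coordinate
            \<open>Suc k\<close> changes none of the \<open>x j\<close> in them.\<close>
          have neq: "j \<noteq> Suc k" if "j \<in> L i" for j
            using L[of i] that i by auto
          show "(x(Suc k := y)) i \<in> D \<and> (\<forall>j\<in>L i. Q i j ((x(Suc k := y)) i) ((x(Suc k := y)) j))"
          proof (cases "i = Suc k")
            case True
            then show ?thesis using \<open>y \<in> B\<close> neq by (auto simp: B_def)
          next
            case False
            then show ?thesis using \<open>C k x\<close> i neq by (auto simp: C_def)
          qed
        qed
        moreover have "x(Suc k := y) \<in> space (?P (Suc k))"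
          using x y unfolding ins space_PiM by (auto simp: PiE_fun_upd)
        ultimately show "(indicator B y :: ennreal) \<le>
            indicator {x \<in> space (?P (Suc k)). C (Suc k) x} (x(Suc k := y))"
          by (auto simp: indicator_def)
      qed
      finally show ?thesis using x True by simp
    qed simp
  qed
  also have "\<dots> = (\<integral>\<^sup>+x. indicator {x \<in> space (?P (Suc k)). C (Suc k) x} x \<partial>?P (Suc k))"
    unfolding ins using ms[of "Suc k" "insert (Suc k) {1..k}", OF equalityD1[OF ins]]
    by (subst P.product_nn_integral_insert) (auto simp: pred_def ins)
  also have "\<dots> = emeasure (?P (Suc k)) {x \<in> space (?P (Suc k)). C (Suc k) x}"
    using ms[of "Suc k" "{1..Suc k}"] by (simp add: pred_def)
  finally show ?case
    unfolding C_def .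
qed

section \<open>Distance constraints on the circle and on the torus\<close>

text \<open>The points farther than \<open>p / 2\<close> from \<open>a\<close> form an arc of length
  \<open>1 - p\<close> opposite to \<open>a\<close>. Cut open at 0, it becomes a piece
  \<open>?A\<close> above \<open>a\<close> and a piece \<open>?B\<close> below it, either of which
  may be empty.\<close>

lemma measure_circle_dist_gt_le:
  assumes a: "a \<in> {0..<1}" and p: "0 \<le> p" "p \<le> 1"
  shows "measure (uniform_measure lborel {0..<1::real}) {u \<in> {0..<1}. circle_dist u a > p / 2} \<le> 1 - p"
proof -
  let ?A = "{a + p / 2 <..< min 1 (a + 1 - p / 2)}" and ?B = "{max 0 (a - 1 + p / 2) ..< a - p / 2}"
  have "{u \<in> {0..<1}. circle_dist u a > p / 2} \<subseteq> ?A \<union> ?B"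
    using a by (auto simp: circle_dist_def abs_if split: if_splits)
  then have sub: "{0..<1} \<inter> {u \<in> {0..<1}. circle_dist u a > p / 2} \<subseteq> ?A \<union> ?B"
    by auto
  \<comment> \<open>The \<open>max 0\<close> covers an interval whose end points are in the wrong
    order.\<close>
  have mA: "measure lborel ?A = max 0 (min 1 (a + 1 - p / 2) - (a + p / 2))"
    by (cases "a + p / 2 \<le> min 1 (a + 1 - p / 2)") auto
  have mB: "measure lborel ?B = max 0 (a - p / 2 - max 0 (a - 1 + p / 2))"
    by (cases "max 0 (a - 1 + p / 2) \<le> a - p / 2") auto
  have "measure (uniform_measure lborel {0..<1::real}) {u \<in> {0..<1}. circle_dist u a > p / 2}
    = measure lborel ({0..<1} \<inter> {u \<in> {0..<1}. circle_dist u a > p / 2})"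
    unfolding circle_dist_def by (subst measure_uniform_measure) auto
  also have "\<dots> \<le> measure lborel (?A \<union> ?B)"
    by (rule measure_mono_fmeasurable[OF sub])
      (auto simp: circle_dist_def intro!: fmeasurable.Un fmeasurableI emeasure_bounded_finite)
  also have "\<dots> \<le> measure lborel ?A + measure lborel ?B"
    by (rule measure_Un_le) auto
  also have "\<dots> \<le> 1 - p"
    unfolding mA mB using a p by (auto simp: min_def max_def)
  finally show ?thesis .
qed

text \<open>Within one coordinate the union bound over \<open>L\<close> controls the failures;
  across coordinates the event is a box, so masses multiply. \<open>nonneg\<close> is what allows
  the \<open>d\<close> inequalities to be multiplied. The event keeps \<open>y\<close> inside the
  unit cube so that \<open>y\<close> can later act as one of the points \<open>a j\<close>.\<close>

lemma emeasure_torus_ge: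
  fixes p :: "nat \<Rightarrow> real"
  assumes L: "finite L" and a: "\<And>j l. j \<in> L \<Longrightarrow> l \<in> {1..d} \<Longrightarrow> a j l \<in> {0..<1}"
    and p: "\<And>j. j \<in> L \<Longrightarrow> 0 \<le> p j \<and> p j \<le> 1"
    and nonneg: "0 \<le> 1 - (\<Sum>j\<in>L. 1 - p j)"
  shows "ennreal ((1 - (\<Sum>j\<in>L. 1 - p j)) ^ d) \<le> emeasure (torus_measure d)
    {y \<in> space (torus_measure d). (\<forall>l\<in>{1..d}. y l \<in> {0..<1}) \<and>
      (\<forall>j\<in>L. \<forall>l\<in>{1..d}. circle_dist (y l) (a j l) \<le> p j / 2)}" (is "_ \<le> emeasure _ ?E")
proof -
  let ?U = "uniform_measure lborel {0..<1::real}"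
  interpret U: prob_space ?U by (rule prob_space_uniform_measure) auto
  interpret P: product_sigma_finite "\<lambda>_::nat. ?U" ..
  define G where "G l = {u \<in> {0..<1}. \<forall>j\<in>L. circle_dist u (a j l) \<le> p j / 2}" for l
  have bad [measurable]: "{u \<in> {0..<1}. circle_dist u (a j l) > p j / 2} \<in> sets borel" for j l
    unfolding circle_dist_def by measurable
  define B where "B l = (\<Union>j\<in>L. {u \<in> {0..<1}. circle_dist u (a j l) > p j / 2})" for l
  have B [measurable]: "B l \<in> sets borel" for l
    unfolding B_def by (rule sets.finite_UN[OF L bad])
  \<comment> \<open>Bad sets are taken inside \<open>{0..<1}\<close>, which has mass 1, so the mass
    of \<open>G l\<close> is 1 minus that of \<open>B l\<close>.\<close>
  have GB: "G l = {0..<1} - B l" for l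
    by (auto simp: G_def B_def not_less)
  then have G [measurable]: "G l \<in> sets borel" for l
    by simp
  have "B l \<subseteq> {0..<1}" for l
    by (auto simp: B_def)
  then have mG: "measure ?U (G l) = measure ?U {0..<1} - measure ?U (B l)" for l
    unfolding GB by (intro U.finite_measure_Diff) simp_all
  have "1 - (\<Sum>j\<in>L. 1 - p j) \<le> measure ?U (G l)" if l: "l \<in> {1..d}" for l
  proof -
    have "measure ?U (B l) \<le> (\<Sum>j\<in>L. measure ?U {u \<in> {0..<1}. circle_dist u (a j l) > p j / 2})"
      unfolding B_def using L bad by (intro U.finite_measure_subadditive_finite) (simp_all add: image_subset_iff)
    also have "\<dots> \<le> (\<Sum>j\<in>L. 1 - p j)"
      using a l p by (intro sum_mono measure_circle_dist_gt_le) auto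
    finally show ?thesis
      unfolding mG by (simp add: measure_uniform_measure)
  qed
  then have "(\<Prod>l\<in>{1..d}. 1 - (\<Sum>j\<in>L. 1 - p j)) \<le> (\<Prod>l\<in>{1..d}. measure ?U (G l))"
    using nonneg by (intro prod_mono conjI)
  then have "ennreal ((1 - (\<Sum>j\<in>L. 1 - p j)) ^ d) \<le> ennreal (\<Prod>l\<in>{1..d}. measure ?U (G l))"
    by (intro ennreal_leI) (simp only: prod_constant card_atLeastAtMost diff_Suc_1)
  also have "\<dots> = (\<Prod>l\<in>{1..d}. emeasure ?U (G l))"
    unfolding U.emeasure_eq_measure by (rule prod_ennreal[symmetric]) (rule measure_nonneg)
  also have "\<dots> = emeasure (torus_measure d) (\<Pi>\<^sub>E l\<in>{1..d}. G l)"
    unfolding torus_measure_def by (subst P.emeasure_PiM) auto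
  also have "(\<Pi>\<^sub>E l\<in>{1..d}. G l) = ?E"
    by (auto simp: G_def torus_measure_def space_PiM PiE_def extensional_def)
  finally show ?thesis .
qed

section \<open>Almost sure bounds for weights and conditional probabilities\<close>

text \<open>Bounds every product of two weights below by \<open>w0\<^sup>2\<close>, so that the
  threshold on \<open>n\<close> does not depend on the weights.\<close>

lemma AE_weight_measure_ge:
  assumes "w0 > 0" and "\<beta> > 2"
  shows "AE w in weight_measure w0 \<beta>. w0 \<le> w"
proof -
  interpret real_distribution "weight_measure w0 \<beta>"
    by (rule real_distribution_weight_measure[OF assms])
  \<comment> \<open>The distribution function is 0 at \<open>w0\<close> itself, so the whole
    half-line up to \<open>w0\<close> is null.\<close>
  have "measure (weight_measure w0 \<beta>) {..w0} = 0"
    using assms by (simp add: measure_weight_measure_Iic weight_cdf_def)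
  then have "{..w0} \<in> null_sets (weight_measure w0 \<beta>)"
    by (auto simp: null_sets_def emeasure_eq_measure)
  then show ?thesis
    by (rule AE_I') auto
qed

text \<open>The claim is tested on the set \<open>S\<close> where it fails, which is in
  \<open>F\<close> because both sides are \<open>F\<close>-measurable. There \<open>le\<close> and
  the defining property of conditional expectation force the excess of \<open>R\<close> to integrate
  to 0. That \<open>ennreal\<close> sends negative values of \<open>R\<close> to 0 is harmless, the
  conditional expectation being nonnegative almost everywhere.\<close>

lemma real_cond_exp_indicator_ge:
  assumes "prob_space M" and "subalgebra M F" and E [measurable]: "E \<in> sets M"
    and R: "R \<in> borel_measurable F"
    and le: "\<And>S. S \<in> sets F \<Longrightarrow> (\<integral>\<^sup>+\<omega>. indicator S \<omega> * ennreal (R \<omega>) \<partial>M) \<le> emeasure M (S \<inter> E)"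
  shows "AE \<omega> in M. R \<omega> \<le> real_cond_exp M F (indicator E) \<omega>"
proof -
  interpret prob_space M by fact
  interpret finite_measure_subalgebra M F
    by standard fact
  define g where "g = real_cond_exp M F (indicator E)"
  have intE: "integrable M (indicator E :: 'a \<Rightarrow> real)"
    by (simp add: emeasure_eq_measure)
  have gF: "g \<in> borel_measurable F"
    unfolding g_def by simp
  have [measurable]: "g \<in> borel_measurable M" "R \<in> borel_measurable M"
    using measurable_from_subalg[OF subalg gF] measurable_from_subalg[OF subalg R] by auto
  have g0: "AE \<omega> in M. 0 \<le> g \<omega>"
    unfolding g_def by (rule real_cond_exp_pos) auto
  define S where "S = {\<omega> \<in> space F. g \<omega> < R \<omega>}"
  have SF: "S \<in> sets F"
    unfolding S_def using gF R by measurable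
  then have S [measurable]: "S \<in> sets M"
    using subalg by (auto simp: subalgebra_def)
  have spF: "space F = space M"
    using subalg by (simp add: subalgebra_def)
  have intg: "integrable M (\<lambda>\<omega>. indicator S \<omega> * g \<omega>)"
    using integrable_mult_indicator[OF S real_cond_exp_int(1)[OF intE]] by (simp add: g_def)
  have "emeasure M (S \<inter> E) = ennreal (\<integral>\<omega>. indicator (S \<inter> E) \<omega> \<partial>M)"
    by (simp add: emeasure_eq_measure)
  also have "(\<integral>\<omega>. indicator (S \<inter> E) \<omega> \<partial>M) = (\<integral>\<omega>. indicator S \<omega> * g \<omega> \<partial>M)"
    using real_cond_exp_intA[OF intE SF]
    by (simp add: g_def set_lebesgue_integral_def indicator_inter_arith)
  also have "ennreal \<dots> = (\<integral>\<^sup>+\<omega>. ennreal (indicator S \<omega> * g \<omega>) \<partial>M)"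
    using g0 by (intro nn_integral_eq_integral[symmetric] intg) auto
  finally have eq: "emeasure M (S \<inter> E) = (\<integral>\<^sup>+\<omega>. indicator S \<omega> * ennreal (g \<omega>) \<partial>M)"
    by (simp add: ennreal_mult' ennreal_indicator)
  \<comment> \<open>The difference of the integrals is taken only where the subtracted one is
    finite; by \<open>eq\<close> it is a probability.\<close>
  have "(\<integral>\<^sup>+\<omega>. indicator S \<omega> * ennreal (R \<omega>) - indicator S \<omega> * ennreal (g \<omega>) \<partial>M)
    = (\<integral>\<^sup>+\<omega>. indicator S \<omega> * ennreal (R \<omega>) \<partial>M) - (\<integral>\<^sup>+\<omega>. indicator S \<omega> * ennreal (g \<omega>) \<partial>M)"
  proof (rule nn_integral_diff)
    show "(\<integral>\<^sup>+\<omega>. indicator S \<omega> * ennreal (g \<omega>) \<partial>M) \<noteq> \<infinity>"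
      by (simp flip: eq)
    show "AE \<omega> in M. indicator S \<omega> * ennreal (g \<omega>) \<le> indicator S \<omega> * ennreal (R \<omega>)"
      by (rule AE_I2) (auto simp: S_def indicator_def intro!: ennreal_leI)
  qed measurable
  also have "\<dots> = 0"
  proof (rule diff_eq_0_ennreal)
    show "(\<integral>\<^sup>+\<omega>. indicator S \<omega> * ennreal (R \<omega>) \<partial>M) < top"
      by (rule le_less_trans[OF le[OF SF]]) (simp add: emeasure_eq_measure)
  qed (use le[OF SF] in \<open>simp add: eq\<close>)
  finally have "AE \<omega> in M. indicator S \<omega> * ennreal (R \<omega>) - indicator S \<omega> * ennreal (g \<omega>) = 0"
    by (subst (asm) nn_integral_0_iff_AE) measurable
  with g0 have "AE \<omega> in M. R \<omega> \<le> g \<omega>"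
    using AE_space
  proof eventually_elim
    case (elim \<omega>)
    show ?case
    proof (rule ccontr)
      assume "\<not> ?case"
      then have "\<omega> \<in> S" "g \<omega> < R \<omega>"
        using elim by (auto simp: S_def spF)
      then have "ennreal (R \<omega> - g \<omega>) = 0"
        using elim by (simp add: ennreal_minus)
      with \<open>g \<omega> < R \<omega>\<close> show False
        by (simp add: ennreal_eq_0_iff)
    qed
  qed
  then show ?thesis
    by (simp add: g_def)
qed

section \<open>Positions of the chosen vertices\<close>

text \<open>Carries the sequential estimate over to all \<open>n\<close> positions: as
  \<open>v\<close> is injective, the positions of the chosen vertices are \<open>k\<close>
  independent torus points.\<close>

lemma emeasure_positions_ge:
  fixes p :: "nat \<Rightarrow> nat \<Rightarrow> real"
  assumes v: "v \<in> vertex_choices n k" and L: "\<And>i. L i \<subseteq> {1..<i}"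
    and p: "\<And>i j. i \<in> {1..k} \<Longrightarrow> j \<in> L i \<Longrightarrow> 0 \<le> p i j \<and> p i j \<le> 1"
    and nonneg: "\<And>i. i \<in> {1..k} \<Longrightarrow> 0 \<le> 1 - (\<Sum>j\<in>L i. 1 - p i j)"
    and E: "E \<in> sets (\<Pi>\<^sub>M u\<in>{1..n}. torus_measure d)"
    and sub: "\<And>x. x \<in> space (\<Pi>\<^sub>M u\<in>{1..n}. torus_measure d) \<Longrightarrow>
      (\<And>i j l. i \<in> {1..k} \<Longrightarrow> j \<in> L i \<Longrightarrow> l \<in> {1..d} \<Longrightarrow>
        circle_dist (x (v i) l) (x (v j) l) \<le> p i j / 2) \<Longrightarrow> x \<in> E"
  shows "ennreal (\<Prod>i=1..k. (1 - (\<Sum>j\<in>L i. 1 - p i j)) ^ d)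
    \<le> emeasure (\<Pi>\<^sub>M u\<in>{1..n}. torus_measure d) E"
proof -
  let ?T = "torus_measure d"
  let ?X = "\<Pi>\<^sub>M u\<in>{1..n}. ?T" and ?Y = "\<Pi>\<^sub>M i\<in>{1..k}. ?T"
  let ?t = "\<lambda>x. \<lambda>i\<in>{1..k}. x (v i)"
  interpret T: prob_space ?T by (rule prob_space_torus_measure)
  have vi: "v i \<in> {1..n}" if "i \<in> {1..k}" for i
    using v that by (auto simp: vertex_choices_def)
  have inj: "inj_on v {1..k}"
    using v by (auto simp: vertex_choices_def)
  have fin: "finite (L i)" for i
    using L finite_subset by blast
  have coord [measurable]: "(\<lambda>y. y l) \<in> borel_measurable ?T" if "l \<in> {1..d}" for l
    unfolding torus_measure_def using that by measurable
  \<comment> \<open>\<^const>\<open>uniform_measure\<close> lives on all of \<open>\<real>\<close>, but \<^const>\<open>circle_dist\<close> is meaningful only on \<open>[0, 1)\<close>.\<close>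
  define D where "D = {y \<in> space ?T. \<forall>l\<in>{1..d}. y l \<in> {0..<1}}"
  define Q where "Q i j y z \<longleftrightarrow> (\<forall>l\<in>{1..d}. circle_dist (y l) (z l) \<le> p i j / 2)"
    for i j :: nat and y z :: "nat \<Rightarrow> real"
  have D [measurable]: "D \<in> sets ?T"
    unfolding D_def by measurable
  have Q: "Measurable.pred (?T \<Otimes>\<^sub>M ?T) (\<lambda>q. Q i j (fst q) (snd q))" for i j
    unfolding Q_def
  proof (rule pred_intros_finite(3))
    fix l assume l: "l \<in> {1..d}"
    have "(\<lambda>q. fst q l) \<in> borel_measurable (?T \<Otimes>\<^sub>M ?T)"
      "(\<lambda>q. snd q l) \<in> borel_measurable (?T \<Otimes>\<^sub>M ?T)"
      using measurable_compose[OF measurable_fst coord[OF l]]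
        measurable_compose[OF measurable_snd coord[OF l]] by auto
    then show "Measurable.pred (?T \<Otimes>\<^sub>M ?T) (\<lambda>q. circle_dist (fst q l) (snd q l) \<le> p i j / 2)"
      unfolding circle_dist_def by measurable
  qed simp
  let ?S = "{x \<in> space ?Y. \<forall>i\<in>{1..k}. x i \<in> D \<and> (\<forall>j\<in>L i. Q i j (x i) (x j))}"
  have "ennreal (\<Prod>i=1..k. (1 - (\<Sum>j\<in>L i. 1 - p i j)) ^ d)
    = (\<Prod>i=1..k. ennreal ((1 - (\<Sum>j\<in>L i. 1 - p i j)) ^ d))"
    using nonneg by (intro prod_ennreal[symmetric] zero_le_power)
  also have "\<dots> \<le> emeasure ?Y ?S"
  proof (rule sequential_constraints_prob_ge[OF T.prob_space_axioms D Q L])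
    fix i and x :: "nat \<Rightarrow> nat \<Rightarrow> real" assume i: "i \<in> {1..k}" and x: "\<And>j. j \<in> {1..<i} \<Longrightarrow> x j \<in> D"
    have *: "{y \<in> space ?T. (\<forall>l\<in>{1..d}. y l \<in> {0..<1}) \<and>
        (\<forall>j\<in>L i. \<forall>l\<in>{1..d}. circle_dist (y l) (x j l) \<le> p i j / 2)}
      = {y \<in> space ?T. y \<in> D \<and> (\<forall>j\<in>L i. Q i j y (x j))}"
      by (auto simp: D_def Q_def)
    have "x j l \<in> {0..<1}" if "j \<in> L i" "l \<in> {1..d}" for j l
    proof -
      have "x j \<in> D" using x L that by blast
      then show ?thesis using that by (auto simp: D_def)
    qed
    from emeasure_torus_ge[where L="L i" and a=x and p="p i" and d=d, OF fin this p[OF i] nonneg[OF i]]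
    show "ennreal ((1 - (\<Sum>j\<in>L i. 1 - p i j)) ^ d)
      \<le> emeasure ?T {y \<in> space ?T. y \<in> D \<and> (\<forall>j\<in>L i. Q i j y (x j))}"
      unfolding * by blast
  qed
  also have "\<dots> \<le> emeasure ?X E"
  \<comment> \<open>A non-measurable set has \<open>emeasure\<close> 0 by convention, so that case
    is trivial and the measurability of \<open>?S\<close> need not be proved.\<close>
  proof (cases "?S \<in> sets ?Y")
    case True
    have t: "?t \<in> ?X \<rightarrow>\<^sub>M ?Y"
      using vi by (intro measurable_restrict measurable_component_singleton) auto
    \<comment> \<open>Reindexing along the injective \<open>v\<close> turns the
      \<open>k\<close>-fold product into a marginal of the \<open>n\<close>-fold one.\<close>
    have "?Y = distr ?X ?Y ?t"
      using distr_PiM_reindex[of "{1..n}" "\<lambda>_. ?T" v "{1..k}"] inj vi T.prob_space_axioms by auto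
    then have "emeasure ?Y ?S = emeasure ?X (?t -` ?S \<inter> space ?X)"
      using emeasure_distr[OF t True] by simp
    also have "\<dots> \<le> emeasure ?X E"
    proof (rule emeasure_mono[OF _ E], rule subsetI)
      fix x assume x: "x \<in> ?t -` ?S \<inter> space ?X"
      have Lk: "j \<in> {1..k}" if "i \<in> {1..k}" "j \<in> L i" for i j
        using L[of i] that by fastforce
      show "x \<in> E"
      proof (rule sub)
        fix i j l assume ij: "i \<in> {1..k}" "j \<in> L i" and l: "l \<in> {1..d}"
        then have "Q i j (?t x i) (?t x j)"
          using x by blast
        then show "circle_dist (x (v i) l) (x (v j) l) \<le> p i j / 2"
          using ij Lk[OF ij] l by (simp add: Q_def)
      qed (use x in blast)
    qed
    finally show ?thesis .
  qed (simp add: emeasure_notin_sets)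
  finally show ?thesis .
qed

section \<open>The bound and the sigma-algebra of the kappas\<close>

text \<open>Replaces a sum over edges by one over their lower endpoints; with \<open>i\<close>
  fixed, edge and endpoint determine each other.\<close>

definition lower_nbrs :: "nat set set \<Rightarrow> nat \<Rightarrow> nat set" where
  "lower_nbrs A i = {j. {i, j} \<in> lower_edges A i}"

definition edge_bound :: "real \<Rightarrow> nat \<Rightarrow> nat \<Rightarrow> nat \<Rightarrow> nat set set \<Rightarrow> sample \<Rightarrow> real" where
  "edge_bound lam n d k A \<omega> = (\<Prod>i=1..k. (1 - (\<Sum>j\<in>lower_nbrs A i.
     (1 - (kappa lam n \<omega> i j / real n) powr (1 / real d)))) ^ d)"

text \<open>The generators of \<open>kappa_algebra\<close> have the smaller index first, while
  \<open>edge_bound\<close> puts the larger one first.\<close>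

lemma kappa_commute: "kappa lam n \<omega> i j = kappa lam n \<omega> j i"
  by (simp add: kappa_def split_beta mult_ac)

text \<open>Pairs in \<open>index_pairs k\<close> have distinct ends, which makes the
  \<open>j \<le> i\<close> of \<open>lower_edges\<close> strict and leaves only earlier
  vertices.\<close>

lemma lower_nbrs_iff:
  assumes "A \<subseteq> index_pairs k"
  shows "j \<in> lower_nbrs A i \<longleftrightarrow> {i, j} \<in> A \<and> 1 \<le> j \<and> j < i \<and> i \<le> k"
proof
  assume "j \<in> lower_nbrs A i"
  then have *: "{i, j} \<in> A" "j \<le> i"
    by (auto simp: lower_nbrs_def lower_edges_def doubleton_eq_iff)
  with assms have "{i, j} \<in> index_pairs k"
    by blast
  then show "{i, j} \<in> A \<and> 1 \<le> j \<and> j < i \<and> i \<le> k"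
    using * by (auto simp: index_pairs_def doubleton_eq_iff)
qed (auto simp: lower_nbrs_def lower_edges_def)

lemma measurable_kappa:
  assumes "1 \<le> i" "i < j" "j \<le> k"
  shows "(\<lambda>\<omega>. kappa lam n \<omega> i j) \<in> borel_measurable (kappa_algebra lam n k M)"
proof -
  let ?P = "{(i, j). 1 \<le> i \<and> i < j \<and> j \<le> k}"
  let ?f = "\<lambda>\<omega>. \<lambda>(i, j)\<in>?P. kappa lam n \<omega> i j"
  have "?f \<in> kappa_algebra lam n k M \<rightarrow>\<^sub>M (\<Pi>\<^sub>M p\<in>?P. borel)"
    unfolding kappa_algebra_def Let_def
    by (rule measurable_vimage_algebra1) (auto simp: space_PiM)
  moreover have "(\<lambda>y. y (i, j)) \<in> borel_measurable (\<Pi>\<^sub>M p\<in>?P. (borel :: real measure))"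
    using assms by (intro measurable_component_singleton) auto
  ultimately have "(\<lambda>\<omega>. ?f \<omega> (i, j)) \<in> borel_measurable (kappa_algebra lam n k M)"
    by (rule measurable_compose)
  then show ?thesis
    using assms by simp
qed

lemma measurable_edge_bound:
  assumes A: "A \<subseteq> index_pairs k"
  shows "edge_bound lam n d k A \<in> borel_measurable (kappa_algebra lam n k M)"
proof -
  have "(\<lambda>\<omega>. kappa lam n \<omega> i j) \<in> borel_measurable (kappa_algebra lam n k M)"
    if "j \<in> lower_nbrs A i" for i j
    using that measurable_kappa[of j i k lam n M]
    by (subst kappa_commute) (auto simp: lower_nbrs_iff[OF A])
  then show ?thesis
    unfolding edge_bound_def[abs_def]
    by (intro borel_measurable_prod borel_measurable_power borel_measurable_diff borel_measurable_sum
        borel_measurable_const powr_real_measurable borel_measurable_divide)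
qed

text \<open>Each \<open>kappa\<close> ignores positions, so an event generated by them is cut out by
  a position-invariant set. \<open>Z\<close> is not confined to \<open>space M\<close>, hence the
  invariance holds for arbitrary \<open>x\<close> and \<open>x'\<close>.\<close>

lemma sets_kappa_algebraE:
  assumes "S \<in> sets (kappa_algebra lam n k M)"
  obtains Z where "\<And>w x x' v. ((w, x), v) \<in> Z \<longleftrightarrow> ((w, x'), v) \<in> Z" and "S = Z \<inter> space M"
proof -
  let ?P = "{(i, j). 1 \<le> i \<and> i < j \<and> j \<le> k}"
  let ?f = "\<lambda>\<omega>. \<lambda>(i, j)\<in>?P. kappa lam n \<omega> i j"
  obtain B where "S = ?f -` B \<inter> space M"
    using assms unfolding kappa_algebra_def Let_def
    by (subst (asm) sets_vimage_algebra2) (auto simp: space_PiM)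
  then show thesis
    by (intro that[of "?f -` B"]) (auto simp: kappa_def)
qed

section \<open>From fixed weights to integrals over the whole sample\<close>

text \<open>The constraints use \<open>p i j / 2\<close> as radius, with \<open>kappa\<close> in
  place of the product of weights. Truncation at \<open>n\<close> keeps \<open>p i j\<close> at most
  1 and can only shrink the radius, so the constraints still imply adjacency. \<open>base\<close>
  makes every factor nonnegative. \<open>x0\<close> is a dummy, as \<open>edge_bound\<close> does
  not depend on positions.\<close>

lemma emeasure_positions_subset_chosen_edges_ge:
  assumes lam: "lam > 0" and w0: "w0 > 0" and nd: "n > 0" "d > 0" and A: "A \<subseteq> index_pairs k"
    and base: "real k * (1 - (lam * w0\<^sup>2 / real n) powr (1 / real d)) \<le> 1"
    and v: "v \<in> vertex_choices n k" and w: "\<And>u. u \<in> {1..n} \<Longrightarrow> w0 \<le> w u"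
    and E: "{x \<in> space (\<Pi>\<^sub>M u\<in>{1..n}. torus_measure d). A \<subseteq> chosen_edges lam n d k ((w, x), v)}
      \<in> sets (\<Pi>\<^sub>M u\<in>{1..n}. torus_measure d)"
  shows "ennreal (edge_bound lam n d k A ((w, x0), v)) \<le> emeasure (\<Pi>\<^sub>M u\<in>{1..n}. torus_measure d)
    {x \<in> space (\<Pi>\<^sub>M u\<in>{1..n}. torus_measure d). A \<subseteq> chosen_edges lam n d k ((w, x), v)}"
proof -
  let ?L = "lower_nbrs A"
  define p where "p i j = (kappa lam n ((w, x0), v) i j / real n) powr (1 / real d)" for i j
  note Liff = lower_nbrs_iff[OF A]
  have L: "?L i \<subseteq> {1..<i}" for i
    by (auto simp: Liff)
  have vi: "w0 \<le> w (v i)" if "i \<in> {1..k}" for i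
    using v that by (intro w) (auto simp: vertex_choices_def)
  have le: "lam * w0\<^sup>2 \<le> lam * w (v i) * w (v j)" if "i \<in> {1..k}" "j \<in> {1..k}" for i j
    using vi[OF that(1)] vi[OF that(2)] lam w0
    by (simp add: power2_eq_square mult.assoc mult_mono)
  have pos: "0 < lam * w0\<^sup>2" using lam w0 by simp
  have p: "0 \<le> p i j \<and> p i j \<le> 1 \<and>
      min 1 ((lam * w0\<^sup>2 / real n) powr (1 / real d)) \<le> p i j \<and>
      p i j \<le> (lam * w (v i) * w (v j) / real n) powr (1 / real d)"
    if "i \<in> {1..k}" "j \<in> {1..k}" for i j
  proof -
    define q where "q = lam * w (v i) * w (v j)"
    have q: "lam * w0\<^sup>2 \<le> q" "0 < q" using le[OF that] pos by (auto simp: q_def)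
    have pe: "p i j = (min q (real n) / real n) powr (1 / real d)"
      by (simp add: p_def kappa_def q_def)
    have "p i j \<le> 1"
      unfolding pe using q nd powr_mono2[of "1 / real d" "min q (real n) / real n" 1]
      by (auto simp: divide_le_eq)
    moreover have "p i j \<le> (q / real n) powr (1 / real d)"
      unfolding pe using q nd by (intro powr_mono2) (auto simp: divide_right_mono)
    moreover have "min 1 ((lam * w0\<^sup>2 / real n) powr (1 / real d)) \<le> p i j"
    proof (cases "q \<le> real n")
      case True
      have "(lam * w0\<^sup>2 / real n) powr (1 / real d) \<le> (q / real n) powr (1 / real d)"
        using q nd pos by (intro powr_mono2) (auto simp: divide_right_mono less_imp_le)
      then show ?thesis using True by (simp add: pe)
    qed (use nd in \<open>simp add: pe\<close>)
    ultimately show ?thesis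
      unfolding q_def by (auto simp: p_def)
  qed
  have k: "i \<in> {1..k}" "j \<in> {1..k}" if "j \<in> ?L i" for i j
    using that by (auto simp: Liff)
  have nonneg: "0 \<le> 1 - (\<Sum>j\<in>?L i. 1 - p i j)" if i: "i \<in> {1..k}" for i
  proof -
    \<comment> \<open>The minimum with 1 accounts for the truncation:
      \<open>lam * w0\<^sup>2\<close> may exceed \<open>n\<close>.\<close>
    define b where "b = min 1 ((lam * w0\<^sup>2 / real n) powr (1 / real d))"
    have "(\<Sum>j\<in>?L i. 1 - p i j) \<le> (\<Sum>j\<in>?L i. 1 - b)"
      using p[OF k] unfolding b_def by (intro sum_mono) (simp add: diff_left_mono)
    also have "\<dots> = real (card (?L i)) * (1 - b)"
      by simp
    also have "\<dots> \<le> real k * (1 - b)"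
    proof (rule mult_right_mono)
      have "card (?L i) \<le> card {1..k}"
        using i by (intro card_mono) (auto simp: Liff)
      then show "real (card (?L i)) \<le> real k" by simp
    qed (simp add: b_def)
    \<comment> \<open>For \<open>b = 1\<close> the left side is 0; otherwise this is
      \<open>base\<close>.\<close>
    also have "\<dots> \<le> 1"
      using base by (auto simp: b_def min_def)
    finally show ?thesis by simp
  qed
  have adj: "A \<subseteq> chosen_edges lam n d k ((w, x), v)"
    if x: "\<And>i j l. i \<in> {1..k} \<Longrightarrow> j \<in> ?L i \<Longrightarrow> l \<in> {1..d} \<Longrightarrow>
      circle_dist (x (v i) l) (x (v j) l) \<le> p i j / 2" for x
  proof
    fix e assume "e \<in> A"
    with A have "e \<in> index_pairs k"
      by blast
    then obtain j i where "e = {j, i}" and ij: "1 \<le> j" "j < i" "i \<le> k"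
      unfolding index_pairs_def by blast
    then have e: "e = {i, j}"
      by blast
    have j: "j \<in> ?L i"
      using \<open>e \<in> A\<close> e ij by (simp add: Liff)
    have "circle_dist (x (v i) l) (x (v j) l) \<le> 1 / 2 * (lam * w (v i) * w (v j) / real n) powr (1 / real d)"
      if "l \<in> {1..d}" for l
      using x[OF k(1)[OF j] j that] p[OF k[OF j]] by linarith
    \<comment> \<open>The maximum is over a nonempty set because \<open>d > 0\<close>.\<close>
    then have "torus_dist d (x (v i)) (x (v j)) \<le> 1 / 2 * (lam * w (v i) * w (v j) / real n) powr (1 / real d)"
      unfolding torus_dist_def using nd by (subst Max_le_iff) auto
    moreover have "v i \<noteq> v j"
      using v k[OF j] ij by (auto simp: vertex_choices_def inj_on_eq_iff)
    ultimately have "girg_adj lam n d (w, x) (v i) (v j)"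
      by (simp add: girg_adj_def)
    then show "e \<in> chosen_edges lam n d k ((w, x), v)"
      unfolding chosen_edges_def e using k[OF j] by auto
  qed
  show ?thesis
    unfolding edge_bound_def p_def[symmetric]
    by (rule emeasure_positions_ge[OF v L _ nonneg E]) (use p k adj in auto)
qed

text \<open>Fubini with the positions innermost: for fixed weights and vertices both membership in
  \<open>S\<close> and the bound are constant in the positions, so the estimate for fixed weights
  can be integrated. The exceptional weights, some of them below \<open>w0\<close>, form a null
  set.\<close>

lemma nn_integral_edge_bound_le:
  fixes n d k :: nat and \<beta> w0 :: real
  assumes lam: "lam > 0" and w0: "w0 > 0" and \<beta>: "\<beta> > 2" and nd: "n > 0" "d > 0" and "k \<le> n"
    and A: "A \<subseteq> index_pairs k"
    and base: "real k * (1 - (lam * w0\<^sup>2 / real n) powr (1 / real d)) \<le> 1"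
  defines "M \<equiv> sample_measure n \<beta> w0 d k"
  assumes S: "S \<in> sets (kappa_algebra lam n k M)"
  shows "(\<integral>\<^sup>+\<omega>. indicator S \<omega> * ennreal (edge_bound lam n d k A \<omega>) \<partial>M)
    \<le> emeasure M (S \<inter> {\<omega> \<in> space M. A \<subseteq> chosen_edges lam n d k \<omega>})"
proof -
  let ?W = "\<Pi>\<^sub>M u\<in>{1..n}. weight_measure w0 \<beta>" and ?X = "\<Pi>\<^sub>M u\<in>{1..n}. torus_measure d"
  let ?U = "uniform_count_measure (vertex_choices n k)"
  let ?R = "edge_bound lam n d k A"
  define E where "E = {\<omega> \<in> space M. A \<subseteq> chosen_edges lam n d k \<omega>}"
  have M: "M = (?W \<Otimes>\<^sub>M ?X) \<Otimes>\<^sub>M ?U"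
    by (simp add: M_def sample_measure_def girg_measure_def)
  have prob_weight: "prob_space (weight_measure w0 \<beta>)"
    using real_distribution_weight_measure[OF w0 \<beta>] by (simp add: real_distribution_def)
  interpret W: prob_space ?W
    by (intro prob_space_PiM prob_weight)
  interpret X: prob_space ?X
    by (intro prob_space_PiM prob_space_torus_measure)
  have "(\<lambda>i\<in>{1..k}. i) \<in> vertex_choices n k"
    using \<open>k \<le> n\<close> by (auto simp: vertex_choices_def inj_on_def)
  then interpret U: prob_space ?U
    by (intro prob_space_uniform_count_measure finite_vertex_choices) auto
  interpret WX: pair_prob_space ?W ?X ..
  interpret MP: pair_sigma_finite "?W \<Otimes>\<^sub>M ?X" ?U ..
  have subalg: "subalgebra M (kappa_algebra lam n k M)"
    unfolding M_def by (rule subalgebra_kappa_algebra)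
  have SM: "S \<in> sets M"
    using S subalg by (auto simp: subalgebra_def)
  have E: "E \<in> sets M"
    unfolding E_def M_def by (rule sets_chosen_edges[OF A nd(2)])
  have R: "?R \<in> borel_measurable M"
    by (rule measurable_from_subalg[OF subalg measurable_edge_bound[OF A]])
  obtain Z where Z: "\<And>w x x' v. ((w, x), v) \<in> Z \<longleftrightarrow> ((w, x'), v) \<in> Z" and SZ: "S = Z \<inter> space M"
    using sets_kappa_algebraE[OF S] by metis
  define f where "f \<omega> = indicator S \<omega> * ennreal (?R \<omega>)" for \<omega>
  define h where "h = (indicator (S \<inter> E) :: _ \<Rightarrow> ennreal)"
  have f: "f \<in> borel_measurable ((?W \<Otimes>\<^sub>M ?X) \<Otimes>\<^sub>M ?U)" and h: "h \<in> borel_measurable ((?W \<Otimes>\<^sub>M ?X) \<Otimes>\<^sub>M ?U)"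
    unfolding f_def[abs_def] h_def M[symmetric] using SM E R by auto
  have ae: "AE w in ?W. \<forall>u\<in>{1..n}. w0 \<le> w u"
    by (intro AE_finite_allI AE_PiM_component prob_weight AE_weight_measure_ge w0 \<beta>) auto
  have "integral\<^sup>N M f = (\<integral>\<^sup>+v. (\<integral>\<^sup>+g. f (g, v) \<partial>(?W \<Otimes>\<^sub>M ?X)) \<partial>?U)"
    unfolding M by (rule MP.nn_integral_snd[OF f, symmetric])
  also have "\<dots> \<le> (\<integral>\<^sup>+v. (\<integral>\<^sup>+g. h (g, v) \<partial>(?W \<Otimes>\<^sub>M ?X)) \<partial>?U)"
  proof (rule nn_integral_mono)
    fix v assume v: "v \<in> space ?U"
    then have vc: "v \<in> vertex_choices n k"
      by (simp add: space_uniform_count_measure)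
    have pair: "(\<lambda>g. (g, v)) \<in> ?W \<Otimes>\<^sub>M ?X \<rightarrow>\<^sub>M (?W \<Otimes>\<^sub>M ?X) \<Otimes>\<^sub>M ?U"
      by (rule measurable_Pair2'[OF v])
    have "(\<integral>\<^sup>+g. f (g, v) \<partial>(?W \<Otimes>\<^sub>M ?X)) = (\<integral>\<^sup>+w. (\<integral>\<^sup>+x. f ((w, x), v) \<partial>?X) \<partial>?W)"
      by (rule X.nn_integral_fst[symmetric]) (rule measurable_compose[OF pair f])
    also have "\<dots> \<le> (\<integral>\<^sup>+w. (\<integral>\<^sup>+x. h ((w, x), v) \<partial>?X) \<partial>?W)"
    proof (rule nn_integral_mono_AE)
      show "AE w in ?W. (\<integral>\<^sup>+x. f ((w, x), v) \<partial>?X) \<le> (\<integral>\<^sup>+x. h ((w, x), v) \<partial>?X)"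
        using ae AE_space
      proof eventually_elim
        case (elim w)
        define E' where "E' = {x \<in> space ?X. A \<subseteq> chosen_edges lam n d k ((w, x), v)}"
        have sp: "((w, x), v) \<in> space M" if "x \<in> space ?X" for x
          using that elim v by (simp add: M space_pair_measure)
        have "(\<lambda>x. ((w, x), v)) \<in> ?X \<rightarrow>\<^sub>M M"
          unfolding M by (rule measurable_compose[OF measurable_Pair1'[OF elim(2)] pair])
        from measurable_sets[OF this E] have E': "E' \<in> sets ?X"
          by (rule back_subst[of "\<lambda>B. B \<in> sets ?X"]) (auto simp: E'_def E_def sp)
        \<comment> \<open>A dummy position: membership in \<open>Z\<close> and the value of the
          bound are the same for every \<open>x\<close>.\<close>
        define x0 :: "nat \<Rightarrow> nat \<Rightarrow> real" where "x0 = undefined"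
        show ?case
        proof (cases "((w, x0), v) \<in> Z")
          case True
          have "(\<integral>\<^sup>+x. f ((w, x), v) \<partial>?X) = (\<integral>\<^sup>+x. ennreal (?R ((w, x0), v)) \<partial>?X)"
          proof (rule nn_integral_cong)
            fix x assume "x \<in> space ?X"
            moreover have "?R ((w, x), v) = ?R ((w, x0), v)"
              by (simp add: edge_bound_def kappa_def)
            ultimately show "f ((w, x), v) = ennreal (?R ((w, x0), v))"
              using True Z[of w x0 v x] by (simp add: f_def SZ sp)
          qed
          also have "\<dots> = ennreal (?R ((w, x0), v))"
            by (simp only: nn_integral_const X.emeasure_space_1 mult_1_right)
          also have "\<dots> \<le> emeasure ?X E'"
            unfolding E'_def
            using emeasure_positions_subset_chosen_edges_ge[OF lam w0 nd A base vc _ E'[unfolded E'_def]] elim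
            by blast
          also have "\<dots> = (\<integral>\<^sup>+x. indicator E' x \<partial>?X)"
            using E' by simp
          also have "\<dots> = (\<integral>\<^sup>+x. h ((w, x), v) \<partial>?X)"
          proof (rule nn_integral_cong)
            fix x assume "x \<in> space ?X"
            then show "indicator E' x = h ((w, x), v)"
              using True Z[of w x0 v x] by (simp add: h_def SZ sp E_def E'_def indicator_def)
          qed
          finally show ?thesis .
        next
          case False
          \<comment> \<open>No positions over this \<open>w\<close> and \<open>v\<close> meet
            \<open>S\<close>, so the left integral vanishes.\<close>
          then have "((w, x), v) \<notin> Z" for x
            using Z by blast
          then have "(\<integral>\<^sup>+x. f ((w, x), v) \<partial>?X) = 0"
            by (simp add: f_def SZ)
          then show ?thesis by simp
        qed
      qed
    qed
    also have "\<dots> = (\<integral>\<^sup>+g. h (g, v) \<partial>(?W \<Otimes>\<^sub>M ?X))"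
      by (rule X.nn_integral_fst) (rule measurable_compose[OF pair h])
    finally show "(\<integral>\<^sup>+g. f (g, v) \<partial>(?W \<Otimes>\<^sub>M ?X)) \<le> (\<integral>\<^sup>+g. h (g, v) \<partial>(?W \<Otimes>\<^sub>M ?X))" .
  qed
  also have "\<dots> = integral\<^sup>N M h"
    unfolding M by (rule MP.nn_integral_snd[OF h])
  also have "\<dots> = emeasure M (S \<inter> E)"
    unfolding h_def using SM E by simp
  finally show ?thesis
    unfolding f_def E_def .
qed

section \<open>Growth of the dimension and the final assembly\<close>

text \<open>The logarithm is \<open>ln c / d n - ln n / d n\<close>, and both terms tend to 0
  because \<open>d n\<close> dominates \<open>ln n\<close>, hence also constants.\<close>

lemma powr_inverse_dimension_tendsto_1:
  fixes d :: "nat \<Rightarrow> nat"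
  assumes c: "c > 0" and d: "(\<lambda>n. real (d n)) \<in> \<omega>(\<lambda>n. ln (real n))"
  shows "(\<lambda>n. (c / real n) powr (1 / real (d n))) \<longlonglongrightarrow> 1"
proof -
  have ln: "(\<lambda>n. ln (real n)) \<in> o(\<lambda>n. real (d n))"
    using d by (simp add: smallomega_iff_smallo)
  have lim_ln: "(\<lambda>n. ln (real n) / real (d n)) \<longlonglongrightarrow> 0"
    by (rule smalloD_tendsto[OF ln])
  have "(\<lambda>_. ln c) \<in> O(\<lambda>n. ln (real n))"
    by real_asymp
  then have "(\<lambda>_. ln c) \<in> o(\<lambda>n. real (d n))"
    using ln by (rule landau_o.big_small_trans)
  then have "(\<lambda>n. ln c / real (d n)) \<longlonglongrightarrow> 0"
    by (rule smalloD_tendsto)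
  with lim_ln have "(\<lambda>n. exp (ln c / real (d n) - ln (real n) / real (d n))) \<longlonglongrightarrow> exp (0 - 0)"
    by (intro tendsto_intros)
  moreover have "\<forall>\<^sub>F n in sequentially.
      exp (ln c / real (d n) - ln (real n) / real (d n)) = (c / real n) powr (1 / real (d n))"
    using eventually_gt_at_top[of 0]
    by eventually_elim (use c in \<open>simp add: powr_def ln_div diff_divide_distrib\<close>)
  ultimately show ?thesis
    using Lim_transform_eventually by fastforce
qed

theorem theorem23:
  fixes lam w0 \<beta> :: real and d :: "nat \<Rightarrow> nat" and k :: nat
  assumes "lam > 0" and "w0 > 0" and "\<beta> > 2"
    and "(\<lambda>n. real (d n)) \<in> \<omega>(\<lambda>n. ln (real n))"
  shows "\<forall>\<^sub>F n in sequentially. \<forall>A \<subseteq> index_pairs k.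
    (let M = sample_measure n \<beta> w0 (d n) k
     in AE \<omega> in M.
          cond_prob_algebra M (kappa_algebra lam n k M)
            (\<lambda>\<omega>'. A \<subseteq> chosen_edges lam n (d n) k \<omega>') \<omega>
          \<ge> (\<Prod>i=1..k. (1 - (\<Sum>j | {i, j} \<in> lower_edges A i.
                 (1 - (kappa lam n \<omega> i j / real n) powr (1 / real (d n))))) ^ d n))"
proof -
  \<comment> \<open>The limit 0 is below 1, so the premise \<open>base\<close> holds for large
    \<open>n\<close>. Neither \<open>A\<close> nor the weights occur in it: one threshold serves all
    \<open>A\<close>.\<close>
  have "(\<lambda>n. real k * (1 - (lam * w0\<^sup>2 / real n) powr (1 / real (d n)))) \<longlonglongrightarrow> real k * (1 - 1)"
    using assms by (intro tendsto_intros powr_inverse_dimension_tendsto_1) auto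
  then have "\<forall>\<^sub>F n in sequentially. real k * (1 - (lam * w0\<^sup>2 / real n) powr (1 / real (d n))) < 1"
    by (rule order_tendstoD) simp
  \<comment> \<open>Positive dimension makes the maximum in \<open>torus_dist\<close> range over a
    nonempty set.\<close>
  moreover have "\<forall>\<^sub>F n in sequentially. d n > 0"
  proof -
    have "\<forall>\<^sub>F n in sequentially. norm (real (d n)) \<ge> 1 * norm (ln (real n))"
      by (rule landau_omega.smallD[OF assms(4)]) simp
    then show ?thesis
      using eventually_gt_at_top[of 1]
    proof eventually_elim
      case (elim n)
      then have "0 < ln (real n)" by simp
      with elim(1) show ?case by (cases "d n") auto
    qed
  qed
  \<comment> \<open>\<open>k \<le> n\<close> guarantees that an injective choice of \<open>k\<close>
    vertices exists.\<close>
  ultimately show ?thesis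
    using eventually_gt_at_top[of 0] eventually_ge_at_top[of k]
  proof eventually_elim
    case (elim n)
    show ?case
    proof (intro allI impI)
      fix A assume A: "A \<subseteq> index_pairs k"
      define M where "M = sample_measure n \<beta> w0 (d n) k"
      have "AE \<omega> in M. edge_bound lam n (d n) k A \<omega> \<le> real_cond_exp M (kappa_algebra lam n k M)
          (indicator {\<omega> \<in> space M. A \<subseteq> chosen_edges lam n (d n) k \<omega>}) \<omega>"
      proof (rule real_cond_exp_indicator_ge)
        show "prob_space M"
          unfolding M_def using assms elim by (intro prob_space_sample_measure)
        show "subalgebra M (kappa_algebra lam n k M)"
          unfolding M_def by (rule subalgebra_kappa_algebra)
        show "{\<omega> \<in> space M. A \<subseteq> chosen_edges lam n (d n) k \<omega>} \<in> sets M"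
          unfolding M_def using A elim by (intro sets_chosen_edges)
        show "edge_bound lam n (d n) k A \<in> borel_measurable (kappa_algebra lam n k M)"
          by (rule measurable_edge_bound[OF A])
      next
        fix S assume "S \<in> sets (kappa_algebra lam n k M)"
        then show "(\<integral>\<^sup>+\<omega>. indicator S \<omega> * ennreal (edge_bound lam n (d n) k A \<omega>) \<partial>M)
            \<le> emeasure M (S \<inter> {\<omega> \<in> space M. A \<subseteq> chosen_edges lam n (d n) k \<omega>})"
          unfolding M_def using assms elim A by (intro nn_integral_edge_bound_le) auto
      qed
      then show "let M = sample_measure n \<beta> w0 (d n) k
        in AE \<omega> in M.
          cond_prob_algebra M (kappa_algebra lam n k M)
            (\<lambda>\<omega>'. A \<subseteq> chosen_edges lam n (d n) k \<omega>') \<omega>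
          \<ge> (\<Prod>i=1..k. (1 - (\<Sum>j | {i, j} \<in> lower_edges A i.
                 (1 - (kappa lam n \<omega> i j / real n) powr (1 / real (d n))))) ^ d n)"
        by (simp only: Let_def M_def cond_prob_algebra_def edge_bound_def lower_nbrs_def)
    qed
  qed
qed

end
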